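(* Let $r\ge1$ and let $\boldsymbol r=(r_{123},r_{124},r_{134},r_{234})\in\mathbb Z_{\ge0}^4$ with $|\boldsymbol r|=r_{123}+r_{124}+r_{134}+r_{234}=r$. There exist Coulomb parameter and mass specialisations (i.e. substitutions expressing $\vec a=(a_1,\dots,a_r)$ and $\vec m=(m_1,\dots,m_r)$ through the parameters $\vec{\mathtt a},\vec\epsilon$ of the tetrahedron instanton theory) such that the equivariant instanton partition functions of the $U(r)$ cohomological field theory with a massive fundamental hypermultiplet on $\mathbb C^4$ and of the cohomological field theory for tetrahedron instantons of type $\boldsymbol r$, of rank $|\boldsymbol r|=r$, are related as $$\boldsymbol{\mathcal Z}^{r}_{\mathbb C^4}(\mathtt q;\vec a,\vec\epsilon,\vec m)=Z^{\boldsymbol r}_{\mathbb C^4}\big((-1)^r\,\mathtt q;\vec{\mathtt a},\vec\epsilon\,\big).$$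
   Context: Parameters: $\vec\epsilon=(\epsilon_1,\epsilon_2,\epsilon_3,\epsilon_4)$ generic with $\epsilon_1+\epsilon_2+\epsilon_3+\epsilon_4=0$; write $\epsilon_{ab}=\epsilon_a+\epsilon_b$ and $\epsilon_{123}=\epsilon_1+\epsilon_2+\epsilon_3=-\epsilon_4$. Let $\underline4^\perp=\{(123),(124),(134),(234)\}$, and for $A\in\underline4^\perp$ let $\bar A$ be the element of $\{1,2,3,4\}$ not in $A$. The Coulomb moduli of the tetrahedron theory are $\vec{\mathtt a}=(\vec{\mathtt a}_A)_{A\in\underline4^\perp}$ with $\vec{\mathtt a}_A=(\mathtt a_{A\,1},\dots,\mathtt a_{A\,r_A})$. Put $P_N(x|\vec w)=\prod_{l=1}^N(x-w_l)$ and $$R_-(x|\vec\epsilon\,)=\frac{x\,(x-\epsilon_{12})(x-\epsilon_{13})(x-\epsilon_{23})}{(x-\epsilon_1)(x-\epsilon_2)(x-\epsilon_3)(x-\epsilon_4)}.$$ Both partition functions are generating functions over the instanton number, $\boldsymbol{\mathcal Z}^r_{\mathbb C^4}=\sum_{k\ge0}\mathtt q^k\,\boldsymbol{\mathcal Z}^{r,k}_{\mathbb C^4}$ and $Z^{\boldsymbol r}_{\mathbb C^4}=\sum_{k\ge0}\mathtt q^k\,Z^{\boldsymbol r,k}_{\mathbb C^4}$, whose coefficients are matrix model contour integrals. Tetrahedron instantons: $$Z^{\boldsymbol r,k}_{\mathbb C^4}(\vec{\mathtt a},\vec\epsilon\,)=\frac{(-1)^k}{k!}\Big(\frac{\epsilon_{12}\epsilon_{13}\epsilon_{23}}{\epsilon_1\epsilon_2\epsilon_3\epsilon_{123}}\Big)^k\oint\prod_{i=1}^k\frac{d\phi_i}{2\pi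 i}\prod_{A\in\underline4^\perp}\frac{P_{r_A}(-\phi_i+\epsilon_{\bar A}\,|-\vec{\mathtt a}_A)}{P_{r_A}(\phi_i|\vec{\mathtt a}_A)}\ \prod_{i\ne j}R_-(\phi_i-\phi_j|\vec\epsilon\,),$$ where the closed contour in $\mathbb C^k$ encircles the poles of the integrand, located on the hyperplanes $\phi_i-\phi_j-\epsilon_a=0$ ($a=1,\dots,4$) and $\phi_i-\mathtt a_{A\,l}=0$. Massive theory on $\mathbb C^4$ (rank $r$ Donaldson–Thomas theory of $\mathbb C^4$ with Coulomb moduli $\vec a$ and masses $\vec m$ of $r$ fundamental matter fields): $$\boldsymbol{\mathcal Z}^{r,k}_{\mathbb C^4}(\vec a,\vec\epsilon,\vec m)=\frac{(-1)^k}{k!}\Big(\frac{\epsilon_{12}\epsilon_{13}\epsilon_{23}}{\epsilon_1\epsilon_2\epsilon_3\epsilon_{123}}\Big)^k\oint\prod_{i=1}^k\frac{d\phi_i}{2\pi i}\,\frac{P_r(\phi_i|\vec m)}{P_r(\phi_i|\vec a)}\ \prod_{i\ne j}R_-(\phi_i-\phi_j|\vec\epsilon\,),$$ with the contour encircling the poles on the hyperplanes $\phi_i-\phi_j-\epsilon_a=0$ and $\phi_i-a_l=0$. *)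

theory Defs
  imports
    "HOL-Complex_Analysis.Complex_Analysis"
    "HOL-Computational_Algebra.Formal_Power_Series"
    "Jordan_Normal_Form.Determinant"
begin

subsection \<open>Parameters\<close>

text \<open>
  The equivariant parameters \<open>\<epsilon> 1, \<dots>, \<epsilon> 4\<close> are generic on the Calabi-Yau locus: they sum to zero, and
  every integer linear relation between them is a multiple of that one.
\<close>

definition generic_cy :: "(nat \<Rightarrow> complex) \<Rightarrow> bool" where
  "generic_cy \<epsilon> \<longleftrightarrow>
     \<epsilon> 1 + \<epsilon> 2 + \<epsilon> 3 + \<epsilon> 4 = 0 \<and>
     (\<forall>n :: nat \<Rightarrow> int. (\<Sum>a = 1..4. of_int (n a) * \<epsilon> a) = 0 \<longrightarrow> n 1 = n 2 \<and> n 2 = n 3 \<and> n 3 = n 4)"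

definition four_perp :: "nat set set" where
  "four_perp = {{1,2,3}, {1,2,4}, {1,3,4}, {2,3,4}}"

definition bar :: "nat set \<Rightarrow> nat" where
  "bar A = the_elem ({1..4} - A)"

definition P :: "nat \<Rightarrow> (nat \<Rightarrow> complex) \<Rightarrow> complex \<Rightarrow> complex" where
  "P N w x = (\<Prod>l = 1..N. (x - w l))"

definition R_minus :: "(nat \<Rightarrow> complex) \<Rightarrow> complex \<Rightarrow> complex" where
  "R_minus \<epsilon> x =
     (x * (x - (\<epsilon> 1 + \<epsilon> 2)) * (x - (\<epsilon> 1 + \<epsilon> 3)) * (x - (\<epsilon> 2 + \<epsilon> 3))) /
     ((x - \<epsilon> 1) * (x - \<epsilon> 2) * (x - \<epsilon> 3) * (x - \<epsilon> 4))"


subsection \<open>Closed contours in \<open>\<complex>\<^sup>k\<close> and integrals over them\<close>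

text \<open>
  A point of \<open>\<complex>\<^sup>k\<close> is a function \<open>\<phi>\<close> of which only the values \<open>\<phi> i\<close>, \<open>i < k\<close>, are used. A closed
  contour is a finite sum of \<open>C\<^sup>1\<close> parametrised \<open>k\<close>-tori, given as a list; orientation is
  part of the parametrisation, and multiplicities are expressed by repetition. The angles of a torus
  are normalised to have period 1.
\<close>

type_synonym torus = "(nat \<Rightarrow> real) \<Rightarrow> nat \<Rightarrow> complex"

abbreviation angles :: "nat \<Rightarrow> (nat \<Rightarrow> real) set" where
  "angles k \<equiv> PiE {..<k} (\<lambda>_. UNIV)"

definition partial_deriv :: "torus \<Rightarrow> nat \<Rightarrow> nat \<Rightarrow> (nat \<Rightarrow> real) \<Rightarrow> complex" where
  "partial_deriv T i m \<theta> = vector_derivative (\<lambda>t. T (\<theta>(m := t)) i) (at (\<theta> m))"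

definition C1_torus :: "nat \<Rightarrow> torus \<Rightarrow> bool" where
  "C1_torus k T \<longleftrightarrow>
     (\<forall>i<k. continuous_on (angles k) (\<lambda>\<theta>. T \<theta> i)) \<and>
     (\<forall>i<k. \<forall>m<k. \<forall>\<theta>\<in>angles k.
        T (\<theta>(m := \<theta> m + 1)) i = T \<theta> i \<and>
        (\<lambda>t. T (\<theta>(m := t)) i) differentiable (at (\<theta> m))) \<and>
     (\<forall>i<k. \<forall>m<k. continuous_on (angles k) (partial_deriv T i m))"

text \<open>The integral of \<open>f d\<phi>\<^sub>0 \<and> \<dots> \<and> d\<phi>\<^sub>k\<^sub>-\<^sub>1\<close>, pulled back to the parameter cube.\<close>

definition torus_integral :: "nat \<Rightarrow> torus \<Rightarrow> ((nat \<Rightarrow> complex) \<Rightarrow> complex) \<Rightarrow> complex" where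
  "torus_integral k T f =
     (\<integral>\<theta>. f (T \<theta>) * Determinant.det (mat k k (\<lambda>(i, m). partial_deriv T i m \<theta>))
        \<partial>(PiM {..<k} (\<lambda>_. restrict_space lborel {0..1})))"

definition contour_integral_Ck :: "nat \<Rightarrow> torus list \<Rightarrow> ((nat \<Rightarrow> complex) \<Rightarrow> complex) \<Rightarrow> complex" where
  "contour_integral_Ck k \<Gamma> f = (\<Sum>T\<leftarrow>\<Gamma>. torus_integral k T f)"

text \<open>
  The affine forms whose zero sets are the hyperplanes carrying the poles, for the set \<open>S\<close> of
  Coulomb moduli.
\<close>

definition polar_forms :: "nat \<Rightarrow> complex set \<Rightarrow> (nat \<Rightarrow> complex) \<Rightarrow> ((nat \<Rightarrow> complex) \<Rightarrow> complex) set" where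
  "polar_forms k S \<epsilon> =
     {\<lambda>\<phi>. \<phi> i - \<phi> j - \<epsilon> a | i j a. i < k \<and> j < k \<and> i \<noteq> j \<and> a \<in> {1..4}} \<union>
     {\<lambda>\<phi>. \<phi> i - s | i s. i < k \<and> s \<in> S}"

text \<open>
  The contour runs in the complement of the polar hyperplanes, and for each of these it contains a
  torus which winds once around it: along one of its angles the affine form winds once around zero.
  The list for \<open>k = 0\<close> is the single point \<open>\<complex>\<^sup>0\<close>, so that the term of instanton number 0 is 1.
\<close>

definition encircles_poles :: "nat \<Rightarrow> complex set \<Rightarrow> (nat \<Rightarrow> complex) \<Rightarrow> torus list \<Rightarrow> bool" where
  "encircles_poles k S \<epsilon> \<Gamma> \<longleftrightarrow>
     (\<forall>T\<in>set \<Gamma>. C1_torus k T \<and> (\<forall>Q\<in>polar_forms k S \<epsilon>. \<forall>\<theta>\<in>angles k. Q (T \<theta>) \<noteq> 0)) \<and>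
     (\<forall>Q\<in>polar_forms k S \<epsilon>. \<exists>T\<in>set \<Gamma>. \<exists>m<k. \<exists>\<theta>\<in>angles k.
        winding_number (\<lambda>t. Q (T (\<theta>(m := t)))) 0 = 1) \<and>
     (k = 0 \<longrightarrow> length \<Gamma> = 1)"

text \<open>
  The hyperplanes do not single out one homology class of contours. A contour prescription selects,
  for every instanton number and every arrangement of polar hyperplanes, a closed contour
  encircling the poles. It depends on the theory only through the location of its poles, and
  turns the partition functions into functions of their parameters.
\<close>

type_synonym prescription = "nat \<Rightarrow> complex set \<Rightarrow> (nat \<Rightarrow> complex) \<Rightarrow> torus list"

definition contour_prescription :: "prescription \<Rightarrow> bool" where
  "contour_prescription C \<longleftrightarrow>
     (\<forall>k S \<epsilon>. finite S \<longrightarrow> S \<noteq> {} \<longrightarrow> generic_cy \<epsilon> \<longrightarrow> encircles_poles k S \<epsilon> (C k S \<epsilon>))"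


subsection \<open>Partition functions\<close>

definition prefactor :: "nat \<Rightarrow> (nat \<Rightarrow> complex) \<Rightarrow> complex" where
  "prefactor k \<epsilon> =
     (-1) ^ k / fact k *
     (((\<epsilon> 1 + \<epsilon> 2) * (\<epsilon> 1 + \<epsilon> 3) * (\<epsilon> 2 + \<epsilon> 3)) /
      (\<epsilon> 1 * \<epsilon> 2 * \<epsilon> 3 * (\<epsilon> 1 + \<epsilon> 2 + \<epsilon> 3))) ^ k"

definition matrix_measure :: "nat \<Rightarrow> (nat \<Rightarrow> complex) \<Rightarrow> (nat \<Rightarrow> complex) \<Rightarrow> complex" where
  "matrix_measure k \<epsilon> \<phi> =
     (\<Prod>(i, j) \<in> {(i, j). i < k \<and> j < k \<and> i \<noteq> j}. R_minus \<epsilon> (\<phi> i - \<phi> j))"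

definition Z_massive_coeff ::
  "prescription \<Rightarrow> nat \<Rightarrow> nat \<Rightarrow> (nat \<Rightarrow> complex) \<Rightarrow> (nat \<Rightarrow> complex) \<Rightarrow> (nat \<Rightarrow> complex) \<Rightarrow> complex" where
  "Z_massive_coeff C r k a \<epsilon> m =
     prefactor k \<epsilon> *
     (contour_integral_Ck k (C k (a ` {1..r}) \<epsilon>)
        (\<lambda>\<phi>. (\<Prod>i<k. P r m (\<phi> i) / P r a (\<phi> i)) * matrix_measure k \<epsilon> \<phi>)
      / (2 * of_real pi * \<i>) ^ k)"

definition Z_massive ::
  "prescription \<Rightarrow> nat \<Rightarrow> (nat \<Rightarrow> complex) \<Rightarrow> (nat \<Rightarrow> complex) \<Rightarrow> (nat \<Rightarrow> complex) \<Rightarrow> complex fps" where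
  "Z_massive C r a \<epsilon> m = Abs_fps (\<lambda>k. Z_massive_coeff C r k a \<epsilon> m)"

definition Z_tetra_coeff ::
  "prescription \<Rightarrow> (nat set \<Rightarrow> nat) \<Rightarrow> nat \<Rightarrow> (nat set \<Rightarrow> nat \<Rightarrow> complex) \<Rightarrow> (nat \<Rightarrow> complex) \<Rightarrow> complex" where
  "Z_tetra_coeff C r k a \<epsilon> =
     prefactor k \<epsilon> *
     (contour_integral_Ck k (C k (\<Union>A\<in>four_perp. a A ` {1..r A}) \<epsilon>)
        (\<lambda>\<phi>. (\<Prod>i<k. \<Prod>A\<in>four_perp.
                 P (r A) (\<lambda>l. - a A l) (- \<phi> i + \<epsilon> (bar A)) / P (r A) (a A) (\<phi> i))
              * matrix_measure k \<epsilon> \<phi>)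
      / (2 * of_real pi * \<i>) ^ k)"

definition Z_tetra ::
  "prescription \<Rightarrow> (nat set \<Rightarrow> nat) \<Rightarrow> (nat set \<Rightarrow> nat \<Rightarrow> complex) \<Rightarrow> (nat \<Rightarrow> complex) \<Rightarrow> complex fps" where
  "Z_tetra C r a \<epsilon> = Abs_fps (\<lambda>k. Z_tetra_coeff C r k a \<epsilon>)"

end

theory Submission
  imports Defs
begin

text \<open>
  Enumerate the pairs \<open>(A, l)\<close> with \<open>l \<le> r\<^sub>A A\<close> by \<open>1, \<dots>, r\<close>, and give the \<open>n\<close>-th pair the Coulomb modulus
  \<open>a A l\<close> and the mass \<open>a A l + \<epsilon> (bar A)\<close>. The poles of the two integrands then agree, so both theories
  are integrated over the same contour, and each of the \<open>r\<close> numerator factors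
  \<open>- \<phi> i + \<epsilon> (bar A) + a A l\<close> of the tetrahedron theory is minus the matching factor of the massive
  one. The \<open>k\<close>-th coefficients therefore differ by the sign \<open>(-1) ^ (r * k)\<close>, which the substitution
  in the instanton counting parameter absorbs.
\<close>

text \<open>Integrability of \<open>f\<close> need not be checked: a non-integrable function has
  integral 0, and scaling by a nonzero \<open>c\<close> does not change integrability.\<close>

lemma contour_integral_Ck_cmult:
  "contour_integral_Ck k \<Gamma> (\<lambda>\<phi>. c * f \<phi>) = c * contour_integral_Ck k \<Gamma> f"
proof -
  have "torus_integral k T (\<lambda>\<phi>. c * f \<phi>) = c * torus_integral k T f" for T
    unfolding torus_integral_def by (simp only: mult.assoc integral_mult_right_zero)
  then show ?thesis
    by (simp add: contour_integral_Ck_def sum_list_const_mult)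
qed

lemma P_uminus: "P N (\<lambda>l. - w l) (- x + e) = (-1) ^ N * P N (\<lambda>l. w l + e) x"
proof -
  have "P N (\<lambda>l. - w l) (- x + e) = (\<Prod>l = 1..N. (-1) * (x - (w l + e)))"
    unfolding P_def by (intro prod.cong) auto
  then show ?thesis
    unfolding P_def prod.distrib by simp
qed

lemma finite_four_perp: "finite four_perp"
  by (simp add: four_perp_def)

lemma P_reindex:
  assumes "bij_betw h {1..r} (Sigma I (\<lambda>A. {1..s A}))" "finite I"
  shows "P r (\<lambda>n. case h n of (A, l) \<Rightarrow> w A l) x = (\<Prod>A\<in>I. P (s A) (w A) x)"
proof -
  have "P r (\<lambda>n. case h n of (A, l) \<Rightarrow> w A l) x =
      (\<Prod>p\<in>Sigma I (\<lambda>A. {1..s A}). x - (case p of (A, l) \<Rightarrow> w A l))"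
    unfolding P_def by (rule prod.reindex_bij_betw[OF assms(1)])
  also have "\<dots> = (\<Prod>A\<in>I. P (s A) (w A) x)"
    unfolding P_def using assms(2) by (subst prod.Sigma) (auto intro: prod.cong)
  finally show ?thesis .
qed

lemma Z_massive_coeff_eq_Z_tetra_coeff:
  assumes h: "bij_betw h {1..r} (Sigma four_perp (\<lambda>A. {1..s A}))"
    and s: "(\<Sum>A\<in>four_perp. s A) = r"
  shows "Z_massive_coeff C r k (\<lambda>n. case h n of (A, l) \<Rightarrow> a A l) \<epsilon>
           (\<lambda>n. case h n of (A, l) \<Rightarrow> a A l + \<epsilon> (bar A)) =
         ((-1) ^ r) ^ k * Z_tetra_coeff C s k a \<epsilon>"
    (is "Z_massive_coeff C r k ?a \<epsilon> ?m = _")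
proof -
  have "?a ` {1..r} = (\<lambda>(A, l). a A l) ` h ` {1..r}"
    by (simp add: image_image)
  also have "\<dots> = (\<Union>A\<in>four_perp. a A ` {1..s A})"
    unfolding bij_betw_imp_surj_on[OF h] by force
  finally have poles: "?a ` {1..r} = (\<Union>A\<in>four_perp. a A ` {1..s A})" .
  have sign: "(-1 :: complex) ^ r = (\<Prod>A\<in>four_perp. (-1) ^ s A)"
    by (simp add: power_sum flip: s)
  \<comment> \<open>The signs from \<open>P_uminus\<close> meet those of \<open>sign\<close> and
    square to 1. Zeros of the denominator are included: there both sides are 0, as division by 0
    gives 0.\<close>
  have "P r ?m x / P r ?a x =
      (-1) ^ r * (\<Prod>A\<in>four_perp. P (s A) (\<lambda>l. - a A l) (- x + \<epsilon> (bar A)) / P (s A) (a A) x)" for x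
    unfolding P_reindex[OF h finite_four_perp] P_uminus sign
    by (simp add: prod_dividef flip: prod.distrib power_add mult_2 mult.assoc)
  then have "(\<lambda>\<phi>. (\<Prod>i<k. P r ?m (\<phi> i) / P r ?a (\<phi> i)) * matrix_measure k \<epsilon> \<phi>) =
      (\<lambda>\<phi>. ((-1) ^ r) ^ k * ((\<Prod>i<k. \<Prod>A\<in>four_perp.
          P (s A) (\<lambda>l. - a A l) (- \<phi> i + \<epsilon> (bar A)) / P (s A) (a A) (\<phi> i)) * matrix_measure k \<epsilon> \<phi>))"
    by (simp add: prod.distrib mult.assoc)
  then show ?thesis
    unfolding Z_massive_coeff_def Z_tetra_coeff_def poles
    by (simp only: contour_integral_Ck_cmult) simp
qed

theorem proposition4p66:
  fixes r :: nat and r\<^sub>A :: "nat set \<Rightarrow> nat"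
  assumes "r \<ge> 1"
    and "(\<Sum>A\<in>four_perp. r\<^sub>A A) = r"
  shows "\<exists>(coulomb :: (nat set \<Rightarrow> nat \<Rightarrow> complex) \<Rightarrow> (nat \<Rightarrow> complex) \<Rightarrow> nat \<Rightarrow> complex)
          (mass :: (nat set \<Rightarrow> nat \<Rightarrow> complex) \<Rightarrow> (nat \<Rightarrow> complex) \<Rightarrow> nat \<Rightarrow> complex).
          \<forall>C. contour_prescription C \<longrightarrow>
            (\<forall>a \<epsilon>. generic_cy \<epsilon> \<longrightarrow>
               Z_massive C r (coulomb a \<epsilon>) \<epsilon> (mass a \<epsilon>) =
               fps_compose (Z_tetra C r\<^sub>A a \<epsilon>) (fps_const ((-1) ^ r) * fps_X))"
proof -
  have "card (Sigma four_perp (\<lambda>A. {1..r\<^sub>A A})) = r"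
    using assms(2) finite_four_perp by simp
  then obtain h where h: "bij_betw h {1..r} (Sigma four_perp (\<lambda>A. {1..r\<^sub>A A}))"
    using ex_bij_betw_nat_finite_1[of "Sigma four_perp (\<lambda>A. {1..r\<^sub>A A})"] finite_four_perp by auto
  show ?thesis
  proof (intro exI allI impI)
    fix C a \<epsilon>
    \<comment> \<open>Unification with this goal fixes the witnesses. Since \<open>h\<close> was
      obtained beforehand, they depend on \<open>a\<close> and \<open>\<epsilon>\<close> but not on
      \<open>C\<close>.\<close>
    show "Z_massive C r (\<lambda>n. case h n of (A, l) \<Rightarrow> a A l) \<epsilon>
            (\<lambda>n. case h n of (A, l) \<Rightarrow> a A l + \<epsilon> (bar A)) =
          fps_compose (Z_tetra C r\<^sub>A a \<epsilon>) (fps_const ((-1) ^ r) * fps_X)"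
      by (rule fps_ext)
        (simp add: Z_massive_def Z_tetra_def fps_nth_compose_linear
          Z_massive_coeff_eq_Z_tetra_coeff[OF h assms(2)])
  qed
qed

end
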